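(* Let $\mathsf e\in\{\mathsf w,\mathsf s\}$ and let $M$ be a computation that has a $\to_{\sigma\beta_c}$-normal form $N$ (i.e. $M\to_{\sigma\beta_c}^* N$ with $N$ $\to_{\sigma\beta_c}$-normal). Then every maximal $\Rightarrow_{\mathsf e}$-sequence from $M$ is finite and ends in $N$.
   Context: The computational core $\lambda_{\copyright}$ has values $V,W ::= x \mid \lambda x.M$ and computations $M,N,L ::= \,!V \mid VM$ ($x$ ranging over a countable set of variables, terms up to $\alpha$-renaming). Rules: $\beta_c$: $(\lambda x.M)(!V) \mapsto M\{V/x\}$; $\sigma$: $(\lambda y.N)((\lambda x.M)L) \mapsto (\lambda x.(\lambda y.N)M)L$ provided $x\notin \mathrm{fv}(N)$; $\sigma\beta_c=\sigma\cup\beta_c$. Contexts: $C ::= [\,] \mid\, !(\lambda x.C) \mid VC \mid (\lambda x.C)M$; surface contexts $S ::= [\,]\mid VS\mid(\lambda x.S)M$; weak contexts $W ::= [\,]\mid VW$. $\to_{\sigma\beta_c}$, $\to^{\mathsf s}_{\sigma\beta_c}$, $\to^{\mathsf w}_{\sigma\beta_c}$ are the closures of $\sigma\beta_c$ under all, surface, weak contexts respectively; write $\to^{\mathsf e}$ for $\to^{\mathsf e}_{\sigma\beta_c}$. The iterated reduction $\Rightarrow_{\mathsf e}$ is defined inductively: (i) if $M\to^{\mathsf e} M'$ then $M\Rightarrow_{\mathsf e} M'$; (ii) if $M$ is $\to^{\mathsf e}$-normal, then: $!(\lambda x.P)\Rightarrow_{\mathsf e} !(\lambda x.P')$ whenever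 $P\Rightarrow_{\mathsf e}P'$; $(\lambda x.P)Q\Rightarrow_{\mathsf e}(\lambda x.P')Q$ whenever $P\Rightarrow_{\mathsf e}P'$; and $VQ\Rightarrow_{\mathsf e} VQ'$ whenever $V$ is $\sigma\beta_c$-normal (contains no $\sigma\beta_c$-redex) and $Q\Rightarrow_{\mathsf e}Q'$. A maximal sequence is one that is infinite or ends in a term with no further step. *)

theory Defs
  imports Main "HOL-Library.Extended_Nat"
begin

text \<open>
  Terms modulo \<open>\<alpha>\<close>-renaming are represented with de Bruijn indices;
  \<open>Bang V\<close> is \<open>!V\<close>, and \<open>Lam M\<close> binds index 0 in \<open>M\<close>.
\<close>

datatype val = Var nat | Lam comp
  and comp = Bang val | App val comp

primrec lift_val :: "nat \<Rightarrow> val \<Rightarrow> val" and lift :: "nat \<Rightarrow> comp \<Rightarrow> comp" where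
  "lift_val k (Var i) = Var (if i < k then i else Suc i)"
| "lift_val k (Lam M) = Lam (lift (Suc k) M)"
| "lift k (Bang V) = Bang (lift_val k V)"
| "lift k (App V M) = App (lift_val k V) (lift k M)"

text \<open>
  \<open>subst M U k\<close> replaces index \<open>k\<close> by \<open>U\<close> and lowers the indices above \<open>k\<close>,
  since it is used when the binder of \<open>k\<close> disappears.
\<close>

primrec subst_val :: "val \<Rightarrow> val \<Rightarrow> nat \<Rightarrow> val" and subst :: "comp \<Rightarrow> val \<Rightarrow> nat \<Rightarrow> comp" where
  "subst_val (Var i) U k = (if k < i then Var (i - 1) else if i = k then U else Var i)"
| "subst_val (Lam M) U k = Lam (subst M (lift_val 0 U) (Suc k))"
| "subst (Bang V) U k = Bang (subst_val V U k)"
| "subst (App V M) U k = App (subst_val V U k) (subst M U k)"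

text \<open>
  In rule \<open>sigma\<close>, \<open>N\<close> moves under the binder \<open>x\<close> of \<open>\<lambda>x.M\<close>, just outside its own binder \<open>y\<close>.
  Lifting from cutoff 1 keeps \<open>y\<close> and skips \<open>x\<close>: this is the side condition
  \<open>x \<notin> fv(N)\<close>.
\<close>

inductive root_step :: "comp \<Rightarrow> comp \<Rightarrow> bool" where
  beta_c: "root_step (App (Lam M) (Bang V)) (subst M V 0)"
| sigma: "root_step (App (Lam N) (App (Lam M) L)) (App (Lam (App (Lam (lift 1 N)) M)) L)"

text \<open>
  Plugging is capturing, so no indices are shifted when filling a hole under a binder.
\<close>

datatype ctx = Hole | CBang ctx | CArg val ctx | CFun ctx comp

primrec plug :: "ctx \<Rightarrow> comp \<Rightarrow> comp" where
  "plug Hole R = R"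
| "plug (CBang C) R = Bang (Lam (plug C R))"
| "plug (CArg V C) R = App V (plug C R)"
| "plug (CFun C M) R = App (Lam (plug C R)) M"

abbreviation full_ctxs :: "ctx set" where
  "full_ctxs \<equiv> UNIV"

inductive_set surface_ctxs :: "ctx set" where
  "Hole \<in> surface_ctxs"
| "S \<in> surface_ctxs \<Longrightarrow> CArg V S \<in> surface_ctxs"
| "S \<in> surface_ctxs \<Longrightarrow> CFun S M \<in> surface_ctxs"

inductive_set weak_ctxs :: "ctx set" where
  "Hole \<in> weak_ctxs"
| "W \<in> weak_ctxs \<Longrightarrow> CArg V W \<in> weak_ctxs"

definition step :: "ctx set \<Rightarrow> comp \<Rightarrow> comp \<Rightarrow> bool" where
  "step K M M' \<longleftrightarrow> (\<exists>C\<in>K. \<exists>R R'. root_step R R' \<and> M = plug C R \<and> M' = plug C R')"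

definition normal :: "('a \<Rightarrow> 'a \<Rightarrow> bool) \<Rightarrow> 'a \<Rightarrow> bool" where
  "normal r x \<longleftrightarrow> (\<nexists>y. r x y)"

primrec normal_val :: "val \<Rightarrow> bool" where
  "normal_val (Var i) \<longleftrightarrow> True"
| "normal_val (Lam M) \<longleftrightarrow> normal (step full_ctxs) M"

inductive iter_step :: "ctx set \<Rightarrow> comp \<Rightarrow> comp \<Rightarrow> bool" for e where
  base: "step e M M' \<Longrightarrow> iter_step e M M'"
| bang: "normal (step e) (Bang (Lam P)) \<Longrightarrow> iter_step e P P'
    \<Longrightarrow> iter_step e (Bang (Lam P)) (Bang (Lam P'))"
| fun_body: "normal (step e) (App (Lam P) Q) \<Longrightarrow> iter_step e P P'
    \<Longrightarrow> iter_step e (App (Lam P) Q) (App (Lam P') Q)"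
| arg: "normal (step e) (App V Q) \<Longrightarrow> normal_val V \<Longrightarrow> iter_step e Q Q'
    \<Longrightarrow> iter_step e (App V Q) (App V Q')"

text \<open>
  A finite or infinite sequence is a function \<open>s\<close> with a number \<open>n\<close> of steps,
  \<open>n = \<infinity>\<close> if it is infinite; if \<open>n = enat k\<close>, its terms are \<open>s 0, \<dots>, s k\<close>
  and the values of \<open>s\<close> beyond \<open>k\<close> are irrelevant.
\<close>

definition maximal_seq :: "('a \<Rightarrow> 'a \<Rightarrow> bool) \<Rightarrow> (nat \<Rightarrow> 'a) \<Rightarrow> enat \<Rightarrow> bool" where
  "maximal_seq r s n \<longleftrightarrow>
     (\<forall>i. enat i < n \<longrightarrow> r (s i) (s (Suc i))) \<and>
     (n = \<infinity> \<or> (\<exists>k. n = enat k \<and> normal r (s k)))"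

end

theory Submission
  imports Defs
begin

text \<open>
  The proof uses a syntax-directed big-step normalizer \<open>ev M n R\<close>, where \<open>n\<close> counts the
  \<open>\<beta>\<^sub>c\<close>-steps and \<open>\<sigma>\<close>-steps are free.  Contracting an iterated \<open>\<beta>\<^sub>c\<close>-redex lowers
  \<open>n\<close> by exactly one; a \<open>\<sigma>\<close>-step leaves \<open>n\<close> unchanged and lowers a weight.  Hence the
  sequences are finite, and their last term is still normalized to \<open>R\<close>.  Since weak
  \<open>\<sigma>\<close>-reduction is not confluent, invariance under \<open>\<sigma>\<close> is obtained from a recursively
  defined \<open>\<sigma>\<close>-normal form \<open>snf\<close>, on which \<open>ev\<close> is shown to depend.  That \<open>ev M n N\<close> holds
  for some \<open>n\<close> whenever \<open>M\<close> has normal form \<open>N\<close> follows by expansion along single steps; for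
  a \<open>\<beta>\<^sub>c\<close>-step in an arbitrary context, the induction uses the relation
  ``first weak \<open>\<beta>\<^sub>c\<close>-steps, then the same in the subterms''.
\<close>

section \<open>Lifting and substitution\<close>

lemma lift_lift:
  "i < Suc k \<Longrightarrow> lift_val (Suc k) (lift_val i V) = lift_val i (lift_val k V)"
  "i < Suc k \<Longrightarrow> lift (Suc k) (lift i M) = lift i (lift k M)"
  by (induct V and M arbitrary: i k and i k) auto

lemma lift_subst:
  "j < Suc i \<Longrightarrow> lift_val i (subst_val V U j) = subst_val (lift_val (Suc i) V) (lift_val i U) j"
  "j < Suc i \<Longrightarrow> lift i (subst M U j) = subst (lift (Suc i) M) (lift_val i U) j"
  by (induct V and M arbitrary: i j U and i j U) (auto simp: lift_lift)

lemma lift_subst_lt: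
  "i < Suc j \<Longrightarrow> lift_val i (subst_val V U j) = subst_val (lift_val i V) (lift_val i U) (Suc j)"
  "i < Suc j \<Longrightarrow> lift i (subst M U j) = subst (lift i M) (lift_val i U) (Suc j)"
  by (induct V and M arbitrary: i j U and i j U) (auto simp: lift_lift)

lemma subst_lift [simp]:
  "subst_val (lift_val k V) U k = V"
  "subst (lift k M) U k = M"
  by (induct V and M arbitrary: k U and k U) auto

lemma subst_subst:
  "i < Suc j \<Longrightarrow> subst_val (subst_val V (lift_val i W) (Suc j)) (subst_val U W j) i
     = subst_val (subst_val V U i) W j"
  "i < Suc j \<Longrightarrow> subst (subst M (lift_val i W) (Suc j)) (subst_val U W j) i
     = subst (subst M U i) W j"
  by (induct V and M arbitrary: i j U W and i j U W)
    (simp_all add: diff_Suc lift_lift [symmetric] lift_subst_lt split: nat.split)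

section \<open>Normal forms for \<open>\<sigma>\<close>\<close>

text \<open>Monadic bind on \<sigma>-normal forms: the continuation \<open>N\<close> sinks to the
  end of the spine of bodies of \<open>Q\<close>, so no \<sigma>-redex arises when \<open>N\<close>
  and \<open>Q\<close> have none.\<close>

fun bind :: "comp \<Rightarrow> comp \<Rightarrow> comp" where
  "bind N (Bang V) = App (Lam N) (Bang V)"
| "bind N (App (Var z) L) = App (Lam N) (App (Var z) L)"
| "bind N (App (Lam M) L) = App (Lam (bind (lift 1 N) M)) L"

primrec snf_val :: "val \<Rightarrow> val" and snf :: "comp \<Rightarrow> comp" where
  "snf_val (Var i) = Var i"
| "snf_val (Lam M) = Lam (snf M)"
| "snf (Bang V) = Bang (snf_val V)"
| "snf (App V M) = (case snf_val V of Var z \<Rightarrow> App (Var z) (snf M) | Lam N \<Rightarrow> bind N (snf M))"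

lemma lift_bind: "lift k (bind N Q) = bind (lift (Suc k) N) (lift k Q)"
  by (induct N Q arbitrary: k rule: bind.induct) (simp_all add: lift_lift)

lemma snf_lift:
  "snf_val (lift_val k V) = lift_val k (snf_val V)"
  "snf (lift k M) = lift k (snf M)"
  by (induct V and M arbitrary: k and k) (auto simp: lift_bind split: val.split)

text \<open>The associativity law of monads, which gives both sides of a \<sigma>-step the same
  \<open>snf\<close>.\<close>

lemma bind_assoc: "bind N (bind M Q) = bind (bind (lift 1 N) M) Q"
  by (induct M Q arbitrary: N rule: bind.induct) (simp_all add: lift_bind lift_lift)

lemma snf_bind: "snf (bind N Q) = bind (snf N) (snf Q)"
  by (induct N Q rule: bind.induct) (simp_all add: snf_lift bind_assoc)

lemma snf_idem [simp]: "snf_val (snf_val V) = snf_val V" "snf (snf M) = snf M"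
  by (induct V and M) (auto simp: snf_bind split: val.split)

text \<open>\<open>bind N Q\<close> arises from \<open>App (Lam N) Q\<close> by \<sigma>-steps;
  these survive the substitution, and \<open>bind_assoc\<close> absorbs them in
  \<open>snf\<close>.\<close>

lemma snf_subst_bind: "snf (subst (bind N Q) U k) = snf (subst (App (Lam N) Q) U k)"
proof (induct N Q arbitrary: U k rule: bind.induct)
  case (3 N M L)
  have "subst (lift 1 N) (lift_val 0 (lift_val 0 U)) (Suc (Suc k))
      = lift 1 (subst N (lift_val 0 U) (Suc k))"
    by (simp add: lift_subst_lt lift_lift [of 0 0, simplified])
  with 3 show ?case by (simp add: snf_lift bind_assoc)
qed simp_all

text \<open>The outer \<open>snf\<close> on the right is there because substitution can turn a head
  variable into an abstraction and so create \<sigma>-redexes.\<close>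

lemma snf_subst:
  "snf_val (subst_val V U k) = snf_val (subst_val (snf_val V) (snf_val U) k)"
  "snf (subst M U k) = snf (subst (snf M) (snf_val U) k)"
proof (induct V and M arbitrary: U k and U k)
  case (App V Q)
  then show ?case
    by (cases V) (auto simp: snf_subst_bind snf_lift snf_bind split: val.split)
qed (simp_all add: snf_lift)

lemma snf_sigma: "snf (App (Lam N) (App (Lam M) L)) = snf (App (Lam (App (Lam (lift 1 N)) M)) L)"
  by (simp add: snf_lift bind_assoc)

lemma snf_plug: "snf R = snf R' \<Longrightarrow> snf (plug C R) = snf (plug C R')"
  by (induct C) (auto split: val.split)

text \<open>Arguments count twice, so in a \<sigma>-step the share of \<open>L\<close> falls from
  \<open>4 * weight L\<close> to \<open>2 * weight L\<close>; the \<open>Suc\<close> for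
  \<open>Bang\<close> keeps weights positive.\<close>

primrec weight_val :: "val \<Rightarrow> nat" and weight :: "comp \<Rightarrow> nat" where
  "weight_val (Var i) = 0"
| "weight_val (Lam M) = weight M"
| "weight (Bang V) = Suc (weight_val V)"
| "weight (App V M) = weight_val V + 2 * weight M"

lemma weight_lift [simp]: "weight_val (lift_val k V) = weight_val V" "weight (lift k M) = weight M"
  by (induct V and M arbitrary: k and k) auto

lemma weight_pos: "0 < weight M"
  by (induct M rule: comp.induct [of "\<lambda>_. True"]) auto

lemma weight_sigma: "weight (App (Lam (App (Lam (lift 1 N)) M)) L) < weight (App (Lam N) (App (Lam M) L))"
  using weight_pos [of L] by simp

lemma weight_plug: "weight R' < weight R \<Longrightarrow> weight (plug C R') < weight (plug C R)"
  by (induct C) auto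

section \<open>The big-step normalizer\<close>

inductive ev :: "comp \<Rightarrow> nat \<Rightarrow> comp \<Rightarrow> bool" where
  ev_var: "ev (Bang (Var x)) 0 (Bang (Var x))"
| ev_lam: "ev P n P' \<Longrightarrow> ev (Bang (Lam P)) n (Bang (Lam P'))"
| ev_app: "ev Q n Q' \<Longrightarrow> ev (App (Var z) Q) n (App (Var z) Q')"
| ev_beta: "ev (subst P V 0) n R \<Longrightarrow> ev (App (Lam P) (Bang V)) (Suc n) R"
| ev_stuck: "ev P n P' \<Longrightarrow> ev L m L'
    \<Longrightarrow> ev (App (Lam P) (App (Var z) L)) (n + m) (App (Lam P') (App (Var z) L'))"
| ev_sigma: "ev (App (Lam (App (Lam (lift 1 N)) M)) L) n R
    \<Longrightarrow> ev (App (Lam N) (App (Lam M) L)) n R"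

inductive_cases ev_varE: "ev (Bang (Var x)) n R"
inductive_cases ev_lamE: "ev (Bang (Lam P)) n R"
inductive_cases ev_appE: "ev (App (Var z) Q) n R"
inductive_cases ev_betaE: "ev (App (Lam P) (Bang V)) n R"
inductive_cases ev_stuckE: "ev (App (Lam P) (App (Var z) L)) n R"
inductive_cases ev_sigmaE: "ev (App (Lam N) (App (Lam M) L)) n R"

text \<open>The counterpart of \<open>ev\<close> on \<sigma>-normal forms. After a \<beta>-step the
  term is renormalized, since substitution can create \<sigma>-redexes.\<close>

inductive evs :: "comp \<Rightarrow> nat \<Rightarrow> comp \<Rightarrow> bool" where
  "evs (Bang (Var x)) 0 (Bang (Var x))"
| "evs P n P' \<Longrightarrow> evs (Bang (Lam P)) n (Bang (Lam P'))"
| "evs Q n Q' \<Longrightarrow> evs (App (Var z) Q) n (App (Var z) Q')"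
| "evs (snf (subst P V 0)) n R \<Longrightarrow> evs (App (Lam P) (Bang V)) (Suc n) R"
| "evs P n P' \<Longrightarrow> evs L m L'
    \<Longrightarrow> evs (App (Lam P) (App (Var z) L)) (n + m) (App (Lam P') (App (Var z) L'))"

lemma ev_imp_evs: "ev M n R \<Longrightarrow> evs (snf M) n R"
proof (induct rule: ev.induct)
  case (ev_beta P V n R)
  then show ?case by (simp add: evs.intros(4) flip: snf_subst)
next
  case (ev_sigma N M L n R)
  then show ?case unfolding snf_sigma by simp
qed (auto intro: evs.intros)

text \<open>Contracting \<sigma>-redexes at the root lowers the weight and keeps \<open>snf\<close>,
  and \<open>ev_sigma\<close> undoes each contraction.\<close>

lemma ev_by_canonical:
  assumes "\<And>M'. snf M' = snf M \<Longrightarrow> \<nexists>N P L. M' = App (Lam N) (App (Lam P) L) \<Longrightarrow> ev M' n R"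
  shows "ev M n R"
  using assms
proof (induct M rule: measure_induct_rule [where f = weight])
  case (less M)
  show ?case
  proof (cases "\<exists>N P L. M = App (Lam N) (App (Lam P) L)")
    case True
    then obtain N P L where M: "M = App (Lam N) (App (Lam P) L)" by blast
    have "ev (App (Lam (App (Lam (lift 1 N)) P)) L) n R"
      using less unfolding M snf_sigma by (metis weight_sigma)
    then show ?thesis unfolding M by (rule ev_sigma)
  next
    case False
    with less(2) show ?thesis by blast
  qed
qed

lemma canonical_cases:
  assumes "\<nexists>N P L. M = App (Lam N) (App (Lam P) L)"
  obtains x where "M = Bang (Var x)" | P where "M = Bang (Lam P)" | z Q where "M = App (Var z) Q"
    | P V where "M = App (Lam P) (Bang V)" | P z L where "M = App (Lam P) (App (Var z) L)"
  using assms by (metis comp.exhaust val.exhaust)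

text \<open>Without a \<sigma>-redex at the root, \<open>M\<close> has the same outer shape as
  \<open>snf M\<close>, so each rule of \<open>evs\<close> has its match in
  \<open>ev\<close>.\<close>

lemma evs_imp_ev: "evs T n R \<Longrightarrow> snf M = T \<Longrightarrow> ev M n R"
  by (induct arbitrary: M rule: evs.induct; rule ev_by_canonical; erule canonical_cases)
    (auto intro: ev.intros simp flip: snf_subst)

lemma ev_snf_cong: "snf M = snf M' \<Longrightarrow> ev M n R \<Longrightarrow> ev M' n R"
  using ev_imp_evs evs_imp_ev by metis

section \<open>Iterated steps decrease the normalizer's cost\<close>

inductive sbeta :: "comp \<Rightarrow> comp \<Rightarrow> bool" where
  sbeta_root: "sbeta (App (Lam P) (Bang V)) (subst P V 0)"
| sbeta_arg: "sbeta Q Q' \<Longrightarrow> sbeta (App V Q) (App V Q')"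
| sbeta_fun: "sbeta P P' \<Longrightarrow> sbeta (App (Lam P) Q) (App (Lam P') Q)"

inductive_cases sbeta_BangE: "sbeta (Bang V) R"
inductive_cases sbeta_AppVarE: "sbeta (App (Var z) Q) R"
inductive_cases sbeta_AppLamE: "sbeta (App (Lam P) Q) R"

lemma sbeta_lift: "sbeta M M' \<Longrightarrow> sbeta (lift k M) (lift k M')"
  by (induct arbitrary: k rule: sbeta.induct) (auto simp: lift_subst intro: sbeta.intros)

lemma sbeta_subst: "sbeta M M' \<Longrightarrow> sbeta (subst M U k) (subst M' U k)"
  by (induct arbitrary: U k rule: sbeta.induct)
    (auto simp flip: subst_subst intro: sbeta.intros)

text \<open>Surface steps never enter a \<open>Bang\<close>, so evaluation neither copies nor erases
  the redex, and its contraction saves exactly one \<open>ev_beta\<close>.\<close>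

lemma ev_sbeta: "ev M n R \<Longrightarrow> sbeta M M' \<Longrightarrow> \<exists>k. n = Suc k \<and> ev M' k R"
proof (induct arbitrary: M' rule: ev.induct)
  case (ev_app Q n Q' z)
  from ev_app(3) show ?case
    by (rule sbeta_AppVarE) (use ev_app(2) in \<open>auto intro: ev.intros\<close>)
next
  case (ev_beta P V n R)
  from ev_beta(3) show ?case
  proof (rule sbeta_AppLamE)
    fix P' assume P': "M' = App (Lam P') (Bang V)" "sbeta P P'"
    from ev_beta(2) [OF sbeta_subst [OF P'(2)]] show ?thesis
      unfolding P'(1) by (auto intro: ev.intros)
  qed (use ev_beta(1) in \<open>auto elim: sbeta_BangE\<close>)
next
  case (ev_stuck P n P' L m L' z)
  from ev_stuck(5) show ?case
  proof (rule sbeta_AppLamE)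
    fix P1 assume P1: "M' = App (Lam P1) (App (Var z) L)" "sbeta P P1"
    from ev_stuck(2) [OF P1(2)] ev_stuck(3) show ?thesis
      unfolding P1(1) by (auto dest: ev.ev_stuck)
  next
    fix Q' assume "M' = App (Lam P) Q'" "sbeta (App (Var z) L) Q'"
    then obtain L1 where L1: "M' = App (Lam P) (App (Var z) L1)" "sbeta L L1"
      by (auto elim: sbeta_AppVarE)
    from ev_stuck(4) [OF L1(2)] ev_stuck(1) show ?thesis
      unfolding L1(1) by (auto dest: ev.ev_stuck)
  qed auto
next
  case (ev_sigma N M L n R)
  have arg: ?case if "sbeta (App (Lam M) L) Q'" and M': "M' = App (Lam N) Q'" for Q'
    using that(1)
  proof (rule sbeta_AppLamE)
    \<comment> \<open>The inner \<beta>-redex becomes the root redex after the \<sigma>-step, and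
      the substitution cancels the lifting of \<open>N\<close>.\<close>
    fix V assume "L = Bang V" "Q' = subst M V 0"
    with ev_sigma(2) [of M'] show ?thesis
      unfolding M' using sbeta_root [of "App (Lam (lift 1 N)) M" V] by simp
  next
    fix L1 assume "Q' = App (Lam M) L1" "sbeta L L1"
    with ev_sigma(2) [OF sbeta_arg] show ?thesis unfolding M' by (blast intro: ev.intros)
  next
    fix M1 assume "Q' = App (Lam M1) L" "sbeta M M1"
    with ev_sigma(2) [OF sbeta_fun [OF sbeta_arg]] show ?thesis
      unfolding M' by (blast intro: ev.intros)
  qed
  from ev_sigma(3) show ?case
  proof (rule sbeta_AppLamE)
    fix N1 assume "M' = App (Lam N1) (App (Lam M) L)" "sbeta N N1"
    with ev_sigma(2) [OF sbeta_fun [OF sbeta_fun [OF sbeta_lift]]] show ?thesis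
      by (blast intro: ev.intros)
  qed (use arg in auto)
qed (auto elim: sbeta_BangE)

lemma sbeta_plug: "C \<in> surface_ctxs \<Longrightarrow> sbeta R R' \<Longrightarrow> sbeta (plug C R) (plug C R')"
  by (induct rule: surface_ctxs.induct) (auto intro: sbeta.intros)

lemma weak_subset_surface: "weak_ctxs \<subseteq> surface_ctxs"
proof
  show "C \<in> surface_ctxs" if "C \<in> weak_ctxs" for C
    using that by (induct rule: weak_ctxs.induct) (auto intro: surface_ctxs.intros)
qed

definition decr :: "comp \<Rightarrow> nat \<Rightarrow> comp \<Rightarrow> nat \<Rightarrow> bool" where
  "decr M' n' M n \<longleftrightarrow> n' < n \<or> n' = n \<and> weight M' < weight M"

lemma step_decr:
  assumes "step e M M'" "e \<subseteq> surface_ctxs" "ev M n R"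
  shows "\<exists>n'. ev M' n' R \<and> decr M' n' M n"
proof -
  from assms obtain C S S' where *: "C \<in> surface_ctxs" "root_step S S'" "M = plug C S" "M' = plug C S'"
    unfolding step_def by blast
  from *(2) show ?thesis
  proof cases
    case (beta_c P V)
    with * have "sbeta M M'" by (auto intro: sbeta_plug sbeta_root)
    with ev_sbeta assms(3) show ?thesis unfolding decr_def by blast
  next
    case (sigma N P L)
    have "snf M = snf M'" unfolding * sigma by (intro snf_plug snf_sigma)
    moreover have "weight M' < weight M" unfolding * sigma by (intro weight_plug weight_sigma)
    ultimately show ?thesis using ev_snf_cong assms(3) unfolding decr_def by blast
  qed
qed

section \<open>Evaluation along iterated steps\<close>

lemma not_root_step_if_normal: "Hole \<in> e \<Longrightarrow> normal (step e) M \<Longrightarrow> \<not> root_step M M'"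
  unfolding normal_def step_def by (metis plug.simps(1))

lemma root_canonical_if_normal:
  assumes "Hole \<in> e" "normal (step e) (App (Lam P) Q)"
  obtains z L where "Q = App (Var z) L"
proof (cases Q)
  case (Bang V)
  with not_root_step_if_normal [OF assms] beta_c show ?thesis by blast
next
  case (App V L)
  with not_root_step_if_normal [OF assms] sigma that show ?thesis by (cases V) blast+
qed

lemma step_AppVar_shape: "step e (App (Var z) Q) M' \<Longrightarrow> \<exists>Q'. M' = App (Var z) Q'"
  unfolding step_def
proof (elim bexE exE conjE)
  fix C R R' assume *: "root_step R R'" "App (Var z) Q = plug C R" "M' = plug C R'"
  then show ?thesis by (cases C) (auto elim: root_step.cases)
qed

lemma iter_step_AppVar_shape: "iter_step e (App (Var z) Q) M' \<Longrightarrow> \<exists>Q'. M' = App (Var z) Q'"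
  by (erule iter_step.cases) (auto dest: step_AppVar_shape)

text \<open>Apart from \<open>base\<close>, the rules act on terms without a root redex. There
  \<open>ev\<close> evaluates the parts separately and adds their costs, so a decrease in one part
  carries over.\<close>

lemma iter_step_decr:
  assumes "iter_step e M M'" "e \<subseteq> surface_ctxs" "Hole \<in> e" "ev M n R"
  shows "\<exists>n'. ev M' n' R \<and> decr M' n' M n"
  using assms(1,4)
proof (induct arbitrary: n R rule: iter_step.induct)
  case (base M M')
  then show ?case using step_decr assms by blast
next
  case (bang P P')
  from bang(4) obtain R0 where R0: "R = Bang (Lam R0)" "ev P n R0" by (auto elim: ev_lamE)
  from bang(3) [OF R0(2)] obtain n' where "ev P' n' R0" "decr P' n' P n" by blast
  then show ?case unfolding R0 decr_def by (intro exI [of _ n']) (auto intro: ev.intros)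
next
  case (fun_body P Q P')
  from root_canonical_if_normal [OF assms(3) fun_body(1)] obtain z L where Q: "Q = App (Var z) L" .
  from fun_body(4) obtain k m P1 L1 where
    *: "n = k + m" "R = App (Lam P1) (App (Var z) L1)" "ev P k P1" "ev L m L1"
    unfolding Q by (auto elim: ev_stuckE)
  from fun_body(3) [OF *(3)] obtain k' where k': "ev P' k' P1" "decr P' k' P k" by blast
  have "ev (App (Lam P') Q) (k' + m) R" unfolding * Q by (intro ev.intros k' *)
  with k'(2) show ?case unfolding decr_def * by (intro exI [of _ "k' + m"]) auto
next
  case (arg V Q Q')
  show ?case
  proof (cases V)
    case (Var z)
    from arg(5) obtain R0 where R0: "R = App (Var z) R0" "ev Q n R0"
      unfolding Var by (auto elim: ev_appE)
    from arg(4) [OF R0(2)] obtain n' where "ev Q' n' R0" "decr Q' n' Q n" by blast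
    then show ?thesis unfolding R0 decr_def Var by (intro exI [of _ n']) (auto intro: ev.intros)
  next
    case (Lam P)
    from root_canonical_if_normal [OF assms(3) arg(1) [unfolded Lam]]
    obtain z L where Q: "Q = App (Var z) L" .
    \<comment> \<open>The reduct of \<open>Q\<close> keeps its variable head, so
      \<open>ev_stuck\<close> still applies to it.\<close>
    with arg(3) iter_step_AppVar_shape obtain L2 where Q': "Q' = App (Var z) L2" by blast
    from arg(5) obtain k m P1 L1 where
      *: "n = k + m" "R = App (Lam P1) (App (Var z) L1)" "ev P k P1" "ev L m L1"
      unfolding Q Lam by (auto elim: ev_stuckE)
    \<comment> \<open>By \<open>ev_app\<close>, \<open>Q\<close> has the same cost \<open>m\<close>
      as \<open>L\<close>, as the induction hypothesis for \<open>Q\<close> requires.\<close>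
    from arg(4) [of m, unfolded Q, OF ev_app, OF *(4)] obtain m' where
      m': "ev L2 m' L1" "decr Q' m' Q m" unfolding Q Q' by (auto elim: ev_appE)
    have "ev (App V Q') (k + m') R" unfolding * Lam Q' by (intro ev.intros m' *)
    with m'(2) show ?thesis unfolding decr_def * by (intro exI [of _ "k + m'"]) auto
  qed
qed

section \<open>Expansion along full \<open>\<beta>\<^sub>c\<close>-steps\<close>

inductive wbeta :: "comp \<Rightarrow> comp \<Rightarrow> bool" where
  wbeta_root: "wbeta (App (Lam P) (Bang V)) (subst P V 0)"
| wbeta_arg: "wbeta Q Q' \<Longrightarrow> wbeta (App V Q) (App V Q')"

lemma ev_wbeta_expansion:
  assumes "wbeta M M'" "ev M' n R"
  shows "ev M (Suc n) R"
proof -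
  \<comment> \<open>The second conjunct treats \<open>M\<close> as an argument; \<open>N\<close> is
    quantified because \<open>ev_sigma\<close> replaces the function body.\<close>
  have "(\<forall>n R. ev M' n R \<longrightarrow> ev M (Suc n) R) \<and>
    (\<forall>N n R. ev (App (Lam N) M') n R \<longrightarrow> ev (App (Lam N) M) (Suc n) R)"
    using assms(1)
  proof (induct rule: wbeta.induct)
    case (wbeta_root P V)
    show ?case
    proof (intro conjI allI impI)
      fix N n R assume "ev (App (Lam N) (subst P V 0)) n R"
      then have "ev (subst (App (Lam (lift 1 N)) P) V 0) n R" by simp
      then show "ev (App (Lam N) (App (Lam P) (Bang V))) (Suc n) R"
        by (intro ev_sigma ev_beta)
    qed (rule ev_beta)
  next
    case (wbeta_arg Q Q' V)
    show ?case
    proof (cases V)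
      case (Var z)
      show ?thesis
      proof (intro conjI allI impI)
        fix n R assume "ev (App V Q') n R"
        with wbeta_arg(2) show "ev (App V Q) (Suc n) R"
          unfolding Var by (auto elim!: ev_appE intro: ev_app)
      next
        fix N n R assume "ev (App (Lam N) (App V Q')) n R"
        then obtain k m P L where *: "n = k + m" "R = App (Lam P) (App (Var z) L)" "ev N k P" "ev Q' m L"
          unfolding Var by (auto elim: ev_stuckE)
        with wbeta_arg(2) have "ev (App (Lam N) (App V Q)) (k + Suc m) R"
          unfolding Var by (blast intro: ev_stuck)
        then show "ev (App (Lam N) (App V Q)) (Suc n) R" using * by simp
      qed
    next
      case (Lam P)
      with wbeta_arg(2) show ?thesis by (auto elim!: ev_sigmaE intro: ev_sigma)
    qed
  qed
  with assms(2) show ?thesis by blast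
qed

lemma ev_wbetas_expansion: "wbeta\<^sup>*\<^sup>* M M' \<Longrightarrow> \<exists>n. ev M' n R \<Longrightarrow> \<exists>n. ev M n R"
  by (induct rule: converse_rtranclp_induct) (auto dest: ev_wbeta_expansion)

section \<open>Weak steps followed by steps in the subterms\<close>

lemma wbeta_lift: "wbeta M M' \<Longrightarrow> wbeta (lift k M) (lift k M')"
  by (induct arbitrary: k rule: wbeta.induct) (auto simp: lift_subst intro: wbeta.intros)

lemma wbeta_subst: "wbeta M M' \<Longrightarrow> wbeta (subst M U k) (subst M' U k)"
  by (induct arbitrary: U k rule: wbeta.induct)
    (auto simp flip: subst_subst intro: wbeta.intros)

lemma wbetas_lift: "wbeta\<^sup>*\<^sup>* M M' \<Longrightarrow> wbeta\<^sup>*\<^sup>* (lift k M) (lift k M')"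
  by (induct rule: rtranclp_induct) (auto dest: wbeta_lift [of _ _ k])

lemma wbetas_subst: "wbeta\<^sup>*\<^sup>* M M' \<Longrightarrow> wbeta\<^sup>*\<^sup>* (subst M U k) (subst M' U k)"
  by (induct rule: rtranclp_induct) (auto dest: wbeta_subst [of _ _ U k])

lemma wbetas_arg: "wbeta\<^sup>*\<^sup>* Q Q' \<Longrightarrow> wbeta\<^sup>*\<^sup>* (App V Q) (App V Q')"
  by (induct rule: rtranclp_induct) (auto dest: wbeta_arg [of _ _ V])

text \<open>A relation in the style of inductive standardization proofs. It contains \<beta>-steps
  in all contexts and is closed under substitution, yet exposes the outer shape by weak steps
  alone.\<close>

inductive std_val :: "val \<Rightarrow> val \<Rightarrow> bool" and std :: "comp \<Rightarrow> comp \<Rightarrow> bool" where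
  std_Var: "std_val (Var x) (Var x)"
| std_Lam: "std P P' \<Longrightarrow> std_val (Lam P) (Lam P')"
| std_Bang: "wbeta\<^sup>*\<^sup>* M (Bang V) \<Longrightarrow> std_val V V' \<Longrightarrow> std M (Bang V')"
| std_App: "wbeta\<^sup>*\<^sup>* M (App V Q) \<Longrightarrow> std_val V V' \<Longrightarrow> std Q Q' \<Longrightarrow> std M (App V' Q')"

inductive_cases std_VarE: "std_val V (Var x)"
inductive_cases std_LamE: "std_val V (Lam P)"
inductive_cases std_BangE: "std M (Bang V)"
inductive_cases std_AppE: "std M (App V Q)"

lemma std_refl: "std_val V V" "std M M"
  by (induct V and M) (auto intro: std_val_std.intros)

lemma std_expansion: "wbeta\<^sup>*\<^sup>* M M0 \<Longrightarrow> std M0 M' \<Longrightarrow> std M M'"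
  by (cases M') (auto elim!: std_BangE std_AppE intro: std_Bang std_App rtranclp_trans)

lemma std_lift:
  "std_val V V' \<Longrightarrow> std_val (lift_val k V) (lift_val k V')"
  "std M M' \<Longrightarrow> std (lift k M) (lift k M')"
proof (induct arbitrary: k and k rule: std_val_std.inducts)
  case (std_Bang M V V')
  then show ?case using wbetas_lift [OF std_Bang(1), of k] by (auto intro: std_val_std.intros)
next
  case (std_App M V Q V' Q')
  then show ?case using wbetas_lift [OF std_App(1), of k] by (auto intro: std_val_std.intros)
qed (auto intro: std_val_std.intros)

lemma std_subst:
  "std_val V V' \<Longrightarrow> std_val U U' \<Longrightarrow> std_val (subst_val V U k) (subst_val V' U' k)"
  "std M M' \<Longrightarrow> std_val U U' \<Longrightarrow> std (subst M U k) (subst M' U' k)"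
proof (induct arbitrary: k U U' and k U U' rule: std_val_std.inducts)
  case (std_Lam P P')
  then show ?case by (simp add: std_val_std.std_Lam std_lift)
next
  case (std_Bang M V V')
  then show ?case using wbetas_subst [OF std_Bang(1), of U k] by (auto intro: std_val_std.intros)
next
  case (std_App M V Q V' Q')
  then show ?case using wbetas_subst [OF std_App(1), of U k] by (auto intro: std_val_std.intros)
qed (auto intro: std_val_std.intros std_lift)

lemma std_plug: "std R R' \<Longrightarrow> std (plug C R) (plug C R')"
  by (induct C) (auto intro: std_val_std.intros std_refl)

text \<open>Weak steps bring \<open>M\<close> to the shape that the rule applied to
  \<open>M'\<close> expects, and are then expanded. The cost may change, since full steps can copy
  or erase redexes.\<close>

lemma ev_std_expansion: "ev M' n R \<Longrightarrow> std M M' \<Longrightarrow> \<exists>m. ev M m R"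
proof (induct arbitrary: M rule: ev.induct)
  case (ev_var x)
  then have "wbeta\<^sup>*\<^sup>* M (Bang (Var x))" by (auto elim!: std_BangE std_VarE)
  then show ?case by (rule ev_wbetas_expansion) (auto intro: ev.intros)
next
  case (ev_lam P' n P'')
  from ev_lam(3) obtain P where *: "wbeta\<^sup>*\<^sup>* M (Bang (Lam P))" "std P P'"
    by (auto elim!: std_BangE std_LamE)
  from *(1) show ?case
    by (rule ev_wbetas_expansion) (use ev_lam(2) *(2) ev.ev_lam in blast)
next
  case (ev_app Q' n Q'' z)
  from ev_app(3) obtain Q where *: "wbeta\<^sup>*\<^sup>* M (App (Var z) Q)" "std Q Q'"
    by (auto elim!: std_AppE std_VarE)
  from *(1) show ?case
    by (rule ev_wbetas_expansion) (use ev_app(2) *(2) ev.ev_app in blast)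
next
  case (ev_beta P' V' n R)
  from ev_beta(3) obtain P Q V where *: "wbeta\<^sup>*\<^sup>* M (App (Lam P) Q)" "std P P'"
    "wbeta\<^sup>*\<^sup>* Q (Bang V)" "std_val V V'"
    by (auto elim!: std_AppE std_LamE std_BangE)
  \<comment> \<open>Arguments are weak positions, so the steps from \<open>Q\<close> extend those
    from \<open>M\<close> and expose the \<beta>-redex.\<close>
  from rtranclp_trans [OF *(1) wbetas_arg [OF *(3)]] show ?case
    by (rule ev_wbetas_expansion) (use ev_beta(2) std_subst *(2,4) ev.ev_beta in blast)
next
  case (ev_stuck P' n P'' L' m L'' z)
  from ev_stuck(5) obtain P Q L where *: "wbeta\<^sup>*\<^sup>* M (App (Lam P) Q)" "std P P'"
    "wbeta\<^sup>*\<^sup>* Q (App (Var z) L)" "std L L'"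
    by (auto elim!: std_AppE std_LamE std_VarE)
  from rtranclp_trans [OF *(1) wbetas_arg [OF *(3)]] show ?case
    by (rule ev_wbetas_expansion) (use ev_stuck(2,4) *(2,4) ev.ev_stuck in blast)
next
  case (ev_sigma N' P' L' n R)
  from ev_sigma(3) obtain N Q P L where *: "wbeta\<^sup>*\<^sup>* M (App (Lam N) Q)" "std N N'"
    "wbeta\<^sup>*\<^sup>* Q (App (Lam P) L)" "std P P'" "std L L'"
    by (auto elim!: std_AppE std_LamE)
  \<comment> \<open>Both sides make the same \<sigma>-step, which keeps them related and fits the
    induction hypothesis.\<close>
  have "std (App (Lam (App (Lam (lift 1 N)) P)) L) (App (Lam (App (Lam (lift 1 N')) P')) L')"
    using *(2,4,5) by (blast intro: std_val_std.intros std_lift)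
  with ev_sigma(2) have "\<exists>m. ev (App (Lam N) (App (Lam P) L)) m R" by (blast intro: ev.ev_sigma)
  with rtranclp_trans [OF *(1) wbetas_arg [OF *(3)]] show ?case by (rule ev_wbetas_expansion)
qed

lemma ev_step_expansion:
  assumes "step full_ctxs M M'" "ev M' n R"
  shows "\<exists>m. ev M m R"
proof -
  from assms obtain C S S' where *: "root_step S S'" "M = plug C S" "M' = plug C S'"
    unfolding step_def by blast
  from *(1) show ?thesis
  proof cases
    case (beta_c P V)
    \<comment> \<open>One weak step, then reflexivity; \<open>std_plug\<close> moves the result into
      the context.\<close>
    then have "std S S'" using std_expansion [OF _ std_refl(2)] wbeta_root by blast
    then show ?thesis using ev_std_expansion assms(2) std_plug unfolding * by blast
  next
    case (sigma N P L)
    have "snf M = snf M'" unfolding * sigma by (intro snf_plug snf_sigma)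
    then show ?thesis using ev_snf_cong assms(2) by metis
  qed
qed

section \<open>Normal terms\<close>

lemma step_plug: "step full_ctxs M M' \<Longrightarrow> step full_ctxs (plug C M) (plug C M')"
  unfolding step_def
proof (elim bexE exE conjE)
  fix D R R' assume *: "root_step R R'" "M = plug D R" "M' = plug D R'"
  \<comment> \<open>A single composed context has to serve both the redex and its
    contractum.\<close>
  have "\<exists>E. \<forall>R. plug C (plug D R) = plug E R"
  proof (induct C)
    case (CBang C)
    then show ?case by (metis plug.simps(2))
  next
    case (CArg V C)
    then show ?case by (metis plug.simps(3))
  next
    case (CFun C Q)
    then show ?case by (metis plug.simps(4))
  qed auto
  with * show "\<exists>C'\<in>full_ctxs. \<exists>R R'. root_step R R' \<and> plug C M = plug C' R \<and> plug C M' = plug C' R'"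
    by blast
qed

lemma normal_plug: "normal (step full_ctxs) (plug C M) \<Longrightarrow> normal (step full_ctxs) M"
  unfolding normal_def using step_plug by blast

lemmas normal_Bang = normal_plug [of "CBang Hole", simplified]
lemmas normal_arg = normal_plug [of "CArg V Hole" for V, simplified]
lemmas normal_fun = normal_plug [of "CFun Hole Q" for Q, simplified]

lemma ev_normal: "normal (step full_ctxs) N \<Longrightarrow> ev N 0 N"
proof (induct N rule: measure_induct_rule [where f = size])
  case (less N)
  have "\<not> root_step N N'" for N'
    by (rule not_root_step_if_normal [OF _ less(2)]) simp
  then have "\<nexists>P M L. N = App (Lam P) (App (Lam M) L)" using sigma by blast
  then show ?case
  proof (cases N rule: canonical_cases)
    case (2 P)
    have "normal (step full_ctxs) P" using less(2) unfolding 2 by (rule normal_Bang)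
    with less(1) 2 show ?thesis by (simp add: ev_lam)
  next
    case (3 z Q)
    have "normal (step full_ctxs) Q" using less(2) unfolding 3 by (rule normal_arg)
    with less(1) 3 show ?thesis by (simp add: ev_app)
  next
    case (4 P V)
    with \<open>\<And>N'. \<not> root_step N N'\<close> beta_c show ?thesis by blast
  next
    case (5 P z L)
    have "normal (step full_ctxs) P" using less(2) unfolding 5 by (rule normal_fun)
    moreover have "normal (step full_ctxs) L"
      using less(2) unfolding 5 by (blast intro: normal_arg)
    ultimately have "ev P 0 P" "ev L 0 L" using less(1) 5 by auto
    then have "ev N (0 + 0) N" unfolding 5 by (rule ev_stuck)
    then show ?thesis by simp
  qed (auto intro: ev.intros)
qed

section \<open>Determinism and progress\<close>

lemma ev_deterministic: "ev M n R \<Longrightarrow> ev M n' R' \<Longrightarrow> R = R'"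
proof (induct arbitrary: n' R' rule: ev.induct)
  case (ev_sigma N M L n R)
  from ev_sigma(3) show ?case by (rule ev_sigmaE) (use ev_sigma(2) in auto)
qed (blast elim: ev_varE ev_lamE ev_appE ev_betaE ev_stuckE)+

text \<open>If \<open>M\<close> is normal for \<open>step e\<close>, the context around some redex
  selects the iteration rule to apply.\<close>

lemma iter_step_if_step:
  assumes "Hole \<in> e"
  shows "step full_ctxs M M' \<Longrightarrow> \<exists>M''. iter_step e M M''"
proof (induct M arbitrary: M' rule: measure_induct_rule [where f = size])
  case (less M)
  show ?case
  proof (cases "normal (step e) M")
    case False
    then show ?thesis unfolding normal_def by (blast intro: iter_step.base)
  next
    case True
    from less(2) obtain C R R' where *: "root_step R R'" "M = plug C R" unfolding step_def by blast
    have IH: "\<exists>Q'. iter_step e (plug D R) Q'" if "size (plug D R) < size M" for D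
      using less(1) [OF that] *(1) unfolding step_def by blast
    show ?thesis
    proof (cases C)
      case Hole
      with * not_root_step_if_normal [OF assms True] show ?thesis by simp
    next
      case (CBang D)
      with * IH [of D] True show ?thesis by (auto intro: iter_step.bang)
    next
      case (CFun D Q)
      with * IH [of D] True show ?thesis by (auto intro: iter_step.fun_body)
    next
      case (CArg V D)
      show ?thesis
      proof (cases "normal_val V")
        case True': True
        with * IH [of D] True CArg show ?thesis by (auto intro: iter_step.arg)
      next
        \<comment> \<open>A redex inside \<open>V\<close> blocks \<open>arg\<close>, but then
          \<open>fun_body\<close> can work inside \<open>V\<close> instead.\<close>
        case False
        then obtain P P' where P: "V = Lam P" "step full_ctxs P P'"
          by (cases V) (auto simp: normal_def)
        with less(1) [OF _ P(2)] * CArg True show ?thesis by (auto intro: iter_step.fun_body)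
      qed
    qed
  qed
qed

theorem mainTheorem8:
  fixes e :: "ctx set" and M N :: comp
  assumes "e \<in> {weak_ctxs, surface_ctxs}"
    and "(step full_ctxs)\<^sup>*\<^sup>* M N" and "normal (step full_ctxs) N"
  shows "\<forall>s n. maximal_seq (iter_step e) s n \<and> s 0 = M \<longrightarrow> (\<exists>k. n = enat k \<and> s k = N)"
proof (intro allI impI)
  fix s n assume "maximal_seq (iter_step e) s n \<and> s 0 = M"
  then have s: "\<And>i. enat i < n \<Longrightarrow> iter_step e (s i) (s (Suc i))"
    and max: "n = \<infinity> \<or> (\<exists>k. n = enat k \<and> normal (iter_step e) (s k))" and s0: "s 0 = M"
    unfolding maximal_seq_def by auto
  have e: "e \<subseteq> surface_ctxs" "Hole \<in> e"
    using assms(1) weak_subset_surface by (auto intro: weak_ctxs.intros surface_ctxs.intros)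
  \<comment> \<open>\<open>N\<close> evaluates to itself, and the reduction from \<open>M\<close> is
    expanded backwards.\<close>
  from assms(2,3) have M: "\<exists>m. ev M m N"
    by (induct rule: converse_rtranclp_induct) (auto dest: ev_normal ev_step_expansion)
  have ev: "\<exists>m. ev (s i) m N" if "enat i \<le> n" for i
    using that
  proof (induct i)
    case 0
    then show ?case using M s0 by simp
  next
    case (Suc i)
    then have "enat i < n" by (simp add: Suc_ile_eq)
    with Suc(1) s iter_step_decr [OF _ e] show ?case by (meson order_less_imp_le)
  qed
  have "n \<noteq> \<infinity>"
  proof
    assume n: "n = \<infinity>"
    \<comment> \<open>Infinite descent on cost and weight, ordered lexicographically as in
      \<open>decr\<close>.\<close>
    have no: "\<not> ev (s i) m N" for i m
    proof (induct "(m, weight (s i))" arbitrary: i m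
        rule: wf_induct_rule [OF wf_lex_prod [OF wf_less_than wf_less_than]])
      case 1
      show ?case
      proof
        assume "ev (s i) m N"
        moreover have "iter_step e (s i) (s (Suc i))" using s n by simp
        ultimately obtain m' where "ev (s (Suc i)) m' N" "decr (s (Suc i)) m' (s i) m"
          using iter_step_decr [OF _ e] by blast
        with 1 [of m' "Suc i"] show False unfolding decr_def by auto
      qed
    qed
    with ev [of 0] n show False by simp
  qed
  with max obtain k where k: "n = enat k" "normal (iter_step e) (s k)" by blast
  then have "normal (step full_ctxs) (s k)"
    using iter_step_if_step [OF e(2)] unfolding normal_def by blast
  \<comment> \<open>The normal term \<open>s k\<close> evaluates both to itself and to
    \<open>N\<close>.\<close>
  with ev [of k] k(1) have "s k = N" using ev_normal ev_deterministic by blast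
  with k(1) show "\<exists>k. n = enat k \<and> s k = N" by blast
qed

end
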